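(* Let $M\subset\mathbb C$ be the set of possible locations of the multipliers of the system $x_{n+1}=F_h(x_n)$, $x_n\in\mathbb R^m$, $h\in H$, at its equilibrium. If the diameter of $M$ is larger than $16$, or the diameter of some connected component of $M$ is larger than $4$, then for every $N$ there is no control of the form $$u=-\sum_{j=1}^{N-1}\varepsilon_j\,(x_{n-j}-x_{n-j+1})$$ with real coefficients $\varepsilon_1,\dots,\varepsilon_{N-1}$ (independent of $h$) that locally stabilizes the equilibrium of the system for all admissible parameters of the system.
   Context: The system $x_{n+1}=F_h(x_n)$, $x_n\in\mathbb R^m$, depends on a parameter vector $h$ from an admissible set $H$; $F_h$ is differentiable and has an equilibrium $x^*=x^*_h$. The multipliers are the eigenvalues $\mu_1,\dots,\mu_m$ of the Jacobi matrix $F_h'(x^* )$; they are known only approximately, and $M\subset\mathbb C$ denotes the set of their possible locations as $h$ ranges over $H$. The closed-loop system is $x_{n+1}=F_h(x_n)+u$. With the convention $\varepsilon_0=\varepsilon_N=0$ and $a_j=\varepsilon_{j-1}-\varepsilon_j$ for $1\le j\le N$ (so $\sum_{j=1}^N a_j=0$), the characteristic polynomial of its linear part at $x^*$ is $$f(\lambda)=\prod_{k=1}^m\big(\lambda^N+(-\mu_k+a_1)\lambda^{N-1}+a_2\lambda^{N-2}+\dots+a_N\big).$$ A polynomial is Schur stable if all its zeros lie in the open unit disc. The control is said to locally stabilize the equilibrium for all admissible parameters if $f$ is Schur stable for all $\mu_1,\dots,\mu_m\in M$, i.e. if $\lambda^N+(-\mu+a_1)\lambda^{N-1}+a_2\lambda^{N-2}+\dots+a_N$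 is Schur stable for every $\mu\in M$. The diameter of a set $E\subset\mathbb C$ is $\sup_{z_1,z_2\in E}|z_1-z_2|$. *)

theory Defs
  imports "HOL-Analysis.Analysis" "HOL-Computational_Algebra.Polynomial"
begin

text \<open>The library's \<open>diameter\<close> is a real supremum, hence unspecified on unbounded sets.
  Here an unbounded set has diameter \<open>\<infinity>\<close>.\<close>

definition ediameter :: "complex set \<Rightarrow> ennreal" where
  "ediameter E = (SUP z1\<in>E. SUP z2\<in>E. ennreal (cmod (z1 - z2)))"

definition jacobi_matrix :: "(real^'m \<Rightarrow> real^'m) \<Rightarrow> real^'m \<Rightarrow> real^'m^'m" where
  "jacobi_matrix f x = matrix (frechet_derivative f (at x))"

text \<open>The multipliers are complex, so the real Jacobi matrix acts on complex vectors.\<close>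

definition multipliers :: "(real^'m \<Rightarrow> real^'m) \<Rightarrow> real^'m \<Rightarrow> complex set" where
  "multipliers f x =
     {\<mu>. \<exists>v::complex^'m. v \<noteq> 0 \<and> map_matrix complex_of_real (jacobi_matrix f x) *v v = \<mu> *s v}"

text \<open>A control law reads the history \<open>y j = x\<^bsub>n-j\<^esub>\<close> of the trajectory at time \<open>n\<close>.
  Only \<open>\<epsilon> 1, \<dots>, \<epsilon> (N - 1)\<close> are used.\<close>

definition delayed_feedback :: "nat \<Rightarrow> (nat \<Rightarrow> real) \<Rightarrow> (nat \<Rightarrow> real^'m) \<Rightarrow> real^'m" where
  "delayed_feedback N \<epsilon> y = - (\<Sum>j=1..N-1. \<epsilon> j *\<^sub>R (y j - y (j - 1)))"

text \<open>The coefficient \<open>a\<^sub>j = \<epsilon>\<^bsub>j-1\<^esub> - \<epsilon>\<^sub>j\<close>, where \<open>\<epsilon>\<^sub>0 = \<epsilon>\<^sub>N = 0\<close> whatever \<open>\<epsilon> 0\<close> and \<open>\<epsilon> N\<close> are.\<close>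

definition gain_coeff :: "nat \<Rightarrow> (nat \<Rightarrow> real) \<Rightarrow> nat \<Rightarrow> real" where
  "gain_coeff N \<epsilon> j =
     (let e = (\<lambda>i. if 1 \<le> i \<and> i < N then \<epsilon> i else 0) in e (j - 1) - e j)"

text \<open>Sanity check: the control contributes \<open>-a\<^sub>j x\<^bsub>n-j+1\<^esub>\<close> to \<open>x\<^bsub>n+1\<^esub>\<close>, which is where the
  coefficients of the characteristic polynomial below come from.\<close>

lemma delayed_feedback_eq_gain_coeff:
  assumes "1 \<le> N"
  shows "delayed_feedback N \<epsilon> y = - (\<Sum>j=1..N. gain_coeff N \<epsilon> j *\<^sub>R y (j - 1))"
proof -
  define e where "e = (\<lambda>i. if 1 \<le> i \<and> i < N then \<epsilon> i else 0)"
  obtain K where N: "N = Suc K" using assms by (cases N) auto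
  have e0: "e 0 = 0" and eN: "e (Suc K) = 0" by (auto simp: e_def N)
  have "(\<Sum>j=1..N. gain_coeff N \<epsilon> j *\<^sub>R y (j - 1)) = (\<Sum>j\<le>K. (e j - e (Suc j)) *\<^sub>R y j)"
    unfolding N by (rule sum.reindex_bij_witness[of _ Suc "\<lambda>j. j - 1"])
      (auto simp: gain_coeff_def e_def N Let_def)
  also have "\<dots> = (\<Sum>j\<le>K. e j *\<^sub>R y j) - (\<Sum>j\<le>K. e (Suc j) *\<^sub>R y j)"
    by (simp add: scaleR_diff_left sum_subtractf)
  also have "(\<Sum>j\<le>K. e j *\<^sub>R y j) = (\<Sum>j=1..K. e j *\<^sub>R y j)"
    by (rule sum.mono_neutral_right) (auto simp: e0 Suc_le_eq intro: gr0I)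
  also have "(\<Sum>j\<le>K. e (Suc j) *\<^sub>R y j) = (\<Sum>j<K. e (Suc j) *\<^sub>R y j)"
    using eN by (simp flip: lessThan_Suc_atMost)
  also have "\<dots> = (\<Sum>j=1..K. e j *\<^sub>R y (j - 1))"
    by (rule sum.reindex_bij_witness[of _ "\<lambda>j. j - 1" Suc]) auto
  finally have "(\<Sum>j=1..N. gain_coeff N \<epsilon> j *\<^sub>R y (j - 1))
      = (\<Sum>j=1..K. e j *\<^sub>R (y j - y (j - 1)))"
    by (simp add: scaleR_diff_right sum_subtractf)
  also have "\<dots> = (\<Sum>j=1..K. \<epsilon> j *\<^sub>R (y j - y (j - 1)))"
    by (rule sum.cong) (auto simp: e_def N)
  finally show ?thesis by (simp add: delayed_feedback_def N)
qed

definition closed_loop_factor :: "nat \<Rightarrow> (nat \<Rightarrow> real) \<Rightarrow> complex \<Rightarrow> complex poly" where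
  "closed_loop_factor N \<epsilon> \<mu> =
     monom 1 N + monom (- \<mu> + complex_of_real (gain_coeff N \<epsilon> 1)) (N - 1)
     + (\<Sum>j=2..N. monom (complex_of_real (gain_coeff N \<epsilon> j)) (N - j))"

definition closed_loop_char_poly :: "nat \<Rightarrow> (nat \<Rightarrow> real) \<Rightarrow> complex^'m \<Rightarrow> complex poly" where
  "closed_loop_char_poly N \<epsilon> \<mu> = (\<Prod>k\<in>UNIV. closed_loop_factor N \<epsilon> (\<mu> $ k))"

definition schur_stable :: "complex poly \<Rightarrow> bool" where
  "schur_stable p \<longleftrightarrow> (\<forall>z. poly p z = 0 \<longrightarrow> cmod z < 1)"

text \<open>For \<open>N \<ge> 1\<close> the law \<open>u\<close> determines \<open>\<epsilon> 1, \<dots>, \<epsilon> (N - 1)\<close>.\<close>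

definition locally_stabilizes ::
  "complex set \<Rightarrow> nat \<Rightarrow> ((nat \<Rightarrow> real^'m) \<Rightarrow> real^'m) \<Rightarrow> bool" where
  "locally_stabilizes M N u \<longleftrightarrow>
     (\<exists>\<epsilon>. u = delayed_feedback N \<epsilon> \<and>
       (\<forall>\<mu>::complex^'m. (\<forall>k. \<mu> $ k \<in> M) \<longrightarrow> schur_stable (closed_loop_char_poly N \<epsilon> \<mu>)))"

end

theory Submission
  imports Defs "HOL-Computational_Algebra.Fundamental_Theorem_Algebra"
    "HOL-Complex_Analysis.Complex_Analysis" "HOL-Real_Asymp.Real_Asymp"
begin

text \<open>
  Reversing the order of the coefficients turns the closed-loop factor with multiplier \<open>w\<close> into
  \<open>Q\<^sub>w(z) = 1 + z B(z) - w z\<close>, where the polynomial \<open>B\<close> depends on the gains only. If the control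
  stabilizes, then no \<open>Q\<^sub>w\<close> with \<open>w \<in> M\<close> vanishes in the unit disc. In other words, the function
  \<open>\<Phi>(z) = 1/z + B(z)\<close> omits \<open>M\<close> on the disc. This confines \<open>M\<close> in two ways.

  Connected sets, bound \<open>4\<close>. The coefficient of \<open>z\<^sup>n\<close> in \<open>1/Q\<^sub>w(z)\<close> is a monic polynomial of degree \<open>n\<close>
  in \<open>w\<close> (\<open>reciprocal_coeff_monic_poly\<close>). If \<open>Q\<^sub>w\<close> has no zeros in the disc, then \<open>1/Q\<^sub>w\<close> is a product
  of at most \<open>K = 1 + deg B\<close> geometric series with ratios of modulus at most \<open>1\<close>, so that the coefficient is
  at most \<open>(n + 1)\<^sup>K\<close> (\<open>inverse_poly_coeff_bound\<close>). On the other hand, a monic polynomial of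
  degree \<open>n\<close> reaches the size \<open>(d/4)\<^sup>n\<close> on every connected set that contains two points at
  distance \<open>d\<close> (\<open>connected_monic_poly_lower_bound\<close>); this says that such a set has logarithmic
  capacity at least \<open>d/4\<close>. Letting \<open>n\<close> grow gives \<open>d \<le> 4\<close>.

  Arbitrary pairs, bound \<open>16\<close>. For \<open>w\<^sub>0, w\<^sub>1 \<in> M\<close> the function
  \<open>h(z) = (w\<^sub>1 - w\<^sub>0) z / Q\<^bsub>w\<^sub>0\<^esub>(z)\<close> is holomorphic in the disc, vanishes only at \<open>0\<close>, omits the
  value \<open>1\<close>, and has derivative \<open>w\<^sub>1 - w\<^sub>0\<close> at \<open>0\<close>. A classical theorem of Hurwitz bounds this
  derivative by \<open>16\<close> (\<open>deriv_le_16_of_omitting_1\<close>). Its usual proof lifts \<open>h\<close> through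
  the elliptic modular function \<open>\<lambda>(q) = 16 q - \<dots>\<close> in the nome \<open>q\<close> and applies the Schwarz lemma to the lift.
  Here the lift is instead obtained as a limit of algebraic functions: the quadratic transformation relating
  \<open>\<lambda>(q)\<close> to \<open>\<lambda>(q\<^sup>2)\<close> involves square roots only. Iterating it \<open>k\<close> times gives functions that
  behave like \<open>\<lambda>(q\<^bsup>2\<^sup>k\<^esup>)\<^bsup>1/2\<^sup>k\<^esup>\<close> and omit all roots of unity of order \<open>2\<^sup>k\<close>. In the limit the whole unit circle
  is omitted, so the limit maps the disc into itself, while its derivative at \<open>0\<close> has modulus at least
  \<open>|w\<^sub>1 - w\<^sub>0| / 16\<close>.
\<close>

section \<open>Connected sets of parameters\<close>

text \<open>Up to the choice of \<open>B\<close>, this is the closed-loop factor with its coefficients in reverse order: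
  \<open>\<lambda>\<^sup>N + (a\<^sub>1 - w) \<lambda>\<^bsup>N-1\<^esup> + \<dots> + a\<^sub>N\<close> becomes \<open>1 + z B(z) - w z\<close> with
  \<open>B(z) = a\<^sub>1 + a\<^sub>2 z + \<dots> + a\<^sub>N z\<^bsup>N-1\<^esup>\<close>. Reversal takes \<open>\<lambda>\<close> to \<open>1/z\<close>, so Schur stability becomes the
  absence of zeros in the closed unit disc.\<close>

definition reversed_factor :: "complex poly \<Rightarrow> complex \<Rightarrow> complex poly" where
  "reversed_factor B w = pCons 1 (B - [:w:])"

text \<open>Projecting \<open>C\<close> and the roots of \<open>G\<close> onto the line through \<open>w\<^sub>0\<close> and \<open>w\<^sub>1\<close> does not increase
  distances, and the projection of \<open>C\<close> contains the segment between the two points. So everything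
  reduces to a segment, which in the coordinate \<open>t\<close> is \<open>[0, 1]\<close>. There the substitution
  \<open>t = (z + 1)\<^sup>2 / (4z)\<close>, which wraps the unit circle around the segment, turns the polynomial times \<open>z\<^sup>n\<close>
  into the polynomial \<open>R\<close> with \<open>R(0) = 4\<^bsup>-n\<^esup>\<close>, and the maximum modulus principle applies to \<open>R\<close>.\<close>
lemma connected_monic_poly_lower_bound:
  fixes G :: "complex poly"
  assumes conn: "connected C" and w0: "w0 \<in> C" and w1: "w1 \<in> C" and ne: "w0 \<noteq> w1"
    and monic: "lead_coeff G = 1"
    and bound: "\<And>w. w \<in> C \<Longrightarrow> cmod (poly G w) \<le> B"
  shows "(cmod (w1 - w0) / 4) ^ degree G \<le> B"
proof -
  define D where "D = w1 - w0"
  have D: "D \<noteq> 0" using ne by (simp add: D_def)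
  define t where "t z = Re ((z - w0) / D)" for z
  define n where "n = degree G"
  obtain \<rho> where "smult (lead_coeff G) (\<Prod>i<degree G. [:- \<rho> i, 1:]) = G"
    by (rule complex_poly_decompose')
  then have G: "G = (\<Prod>i<n. [:- \<rho> i, 1:])" using monic by (simp add: n_def)
  define R where "R = (\<Prod>i<n. [:1/4, 1/2 - complex_of_real (t (\<rho> i)), 1/4:])"
  have R: "poly R z = (\<Prod>i<n. (z + 1)\<^sup>2 / 4 - of_real (t (\<rho> i)) * z)" for z
    unfolding R_def poly_prod
    by (intro prod.cong refl) (simp add: power2_eq_square field_simps)
  have "cmod (poly R 0) \<le> B / cmod D ^ n"
  proof (rule maximum_modulus_frontier[of "poly R" "cball 0 1"])
    fix z :: complex assume "z \<in> frontier (cball 0 1)"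
    then have z: "cmod z = 1" by simp
    then have zc: "z * cnj z = 1" using complex_norm_square[of z] by simp
    define x where "x = (1 + Re z) / 2"
    have "\<bar>Re z\<bar> \<le> 1" using abs_Re_le_cmod[of z] z by simp
    then have x01: "0 \<le> x" "x \<le> 1" by (auto simp: x_def)
    have "connected (t ` C)" unfolding t_def
      by (intro connected_continuous_image conn continuous_intros) (use D in auto)
    moreover have "0 \<in> t ` C" using w0 by (force simp: t_def)
    moreover have "1 \<in> t ` C" using w1 D by (force simp: t_def D_def)
    ultimately have "x \<in> t ` C" using x01 connectedD_interval by blast
    then obtain w where w: "w \<in> C" "t w = x" by auto
    have quad: "(z + 1)\<^sup>2 / 4 = z * of_real x"
    proof -
      have "(z + 1)\<^sup>2 = z * (z + cnj z + 2)" using zc by (simp add: power2_eq_square algebra_simps)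
      also have "z + cnj z + 2 = of_real (4 * x)"
        unfolding complex_add_cnj by (simp add: x_def)
      also have "z * of_real (4 * x) = 4 * (z * of_real x)" by simp
      finally have eq: "(z + 1)\<^sup>2 = 4 * (z * of_real x)" .
      show ?thesis unfolding eq by simp
    qed
    have factor: "cmod ((z + 1)\<^sup>2 / 4 - of_real (t y) * z) * cmod D \<le> cmod (w - y)" for y
    proof -
      have "(z + 1)\<^sup>2 / 4 - of_real (t y) * z = z * of_real (t w - t y)"
        unfolding quad by (simp add: w algebra_simps)
      then have "cmod ((z + 1)\<^sup>2 / 4 - of_real (t y) * z) = \<bar>t w - t y\<bar>"
        using z by (simp add: norm_mult del: of_real_diff)
      also have "t w - t y = Re ((w - y) / D)" by (simp add: t_def diff_divide_distrib)
      also have "\<bar>\<dots>\<bar> \<le> cmod (w - y) / cmod D"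
        using abs_Re_le_cmod[of "(w - y) / D"] by (simp add: norm_divide)
      finally show ?thesis using D by (simp add: field_simps)
    qed
    have "cmod (poly R z) * cmod D ^ n
        = (\<Prod>i<n. cmod ((z + 1)\<^sup>2 / 4 - of_real (t (\<rho> i)) * z) * cmod D)"
      by (simp add: R prod.distrib prod_norm)
    also have "\<dots> \<le> (\<Prod>i<n. cmod (w - \<rho> i))"
      by (intro prod_mono conjI factor) auto
    also have "\<dots> = cmod (poly G w)" by (simp add: G poly_prod prod_norm)
    also have "\<dots> \<le> B" using bound w by blast
    finally show "cmod (poly R z) \<le> B / cmod D ^ n"
      using D by (simp add: field_simps)
  qed (auto intro!: continuous_intros holomorphic_intros)
  moreover have "poly R 0 = (1/4) ^ n"
    by (simp add: R)
  ultimately show ?thesis using D by (simp add: n_def[symmetric] D_def norm_power field_simps norm_divide)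
qed

text \<open>Each root \<open>\<rho>\<close> of \<open>Q\<close> contributes a factor \<open>1 / (1 - z/\<rho>)\<close> to \<open>1/Q\<close>. Multiplication by this geometric
  series replaces the coefficients by weighted partial sums with weights of modulus at most \<open>1\<close>, which
  costs at most one factor \<open>n + 1\<close>.\<close>
lemma inverse_poly_coeff_bound:
  fixes Q :: "complex poly"
  assumes "coeff Q 0 = 1" and "\<And>z. poly Q z = 0 \<Longrightarrow> 1 \<le> cmod z"
  shows "cmod (fps_nth (inverse (fps_of_poly Q)) n) \<le> real (n + 1) ^ degree Q"
  using assms
proof (induction "degree Q" arbitrary: Q n)
  case 0
  then have "Q = 1" by (metis degree_0_id one_pCons pCons_one)
  then show ?case by (simp add: fps_one_nth)
next
  case (Suc d)
  obtain \<rho> where \<rho>: "poly Q \<rho> = 0"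
    using Suc.hyps(2) fundamental_theorem_of_algebra_alt[of Q] by (metis degree_pCons_0 nat.distinct(1))
  have \<rho>1: "1 \<le> cmod \<rho>" using Suc.prems \<rho> by blast
  then have \<rho>0: "\<rho> \<noteq> 0" by auto
  define l where "l = inverse \<rho>"
  have l: "cmod l \<le> 1" using \<rho>1 by (simp add: l_def norm_inverse inverse_le_1_iff)
  obtain P0 where P0: "Q = [:-\<rho>, 1:] * P0" using \<rho> by (metis dvdE poly_eq_0_iff_dvd)
  define P where "P = smult (-\<rho>) P0"
  have QP: "Q = [:1, -l:] * P"
  proof -
    have "[:-\<rho>, 1:] = smult (-\<rho>) [:1, -l:]" using \<rho>0 by (simp add: l_def)
    then show ?thesis unfolding P0 P_def by (metis mult_smult_left mult_smult_right)
  qed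
  have Q0: "Q \<noteq> 0" using Suc.prems(1) by auto
  have P_nz: "P \<noteq> 0" using Q0 QP by auto
  have degP: "d = degree P" 
  proof -
    have "degree Q = degree [:1, -l:] + degree P"
      unfolding QP by (rule degree_mult_eq) (use P_nz in auto)
    then show ?thesis using Suc.hyps(2) \<rho>0 by (simp add: l_def)
  qed
  have P1: "coeff P 0 = 1" using Suc.prems(1) unfolding QP by (simp add: coeff_mult)
  define U V where "U = inverse (fps_of_poly Q)" and "V = inverse (fps_of_poly P)"
  have Vb: "cmod (fps_nth V m) \<le> real (m + 1) ^ d" for m
    unfolding V_def degP using degP P1 by (intro Suc.hyps(1)) (use Suc.prems(2) in \<open>auto simp: QP\<close>)
  have "V = fps_of_poly [:1, -l:] * U"
    unfolding U_def V_def QP fps_of_poly_mult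
    by (subst fps_inverse_mult, subst mult.assoc[symmetric], subst inverse_mult_eq_1') auto
  then have "V = U - fps_const l * fps_X * U"
    by (simp add: fps_of_poly_pCons algebra_simps flip: fps_const_neg)
  then have rec: "fps_nth U (Suc m) = l * fps_nth U m + fps_nth V (Suc m)" 
    and rec0: "fps_nth U 0 = fps_nth V 0" for m
    by (auto simp: mult.assoc)
  have "cmod (fps_nth U m) \<le> real (m + 1) * real (n + 1) ^ d" if "m \<le> n" for m
    using that
  proof (induction m)
    case 0
    then show ?case using Vb[of 0] by (simp add: rec0) (meson le_add1 one_le_power order_trans of_nat_0_le_iff add_increasing2 order_refl le_add_same_cancel2)
  next
    case (Suc m)
    have "cmod (fps_nth U (Suc m)) \<le> cmod l * cmod (fps_nth U m) + cmod (fps_nth V (Suc m))"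
      unfolding rec by (metis norm_mult norm_triangle_ineq)
    also have "\<dots> \<le> 1 * (real (m + 1) * real (n + 1) ^ d) + real (n + 1) ^ d"
      using Suc l Vb[of "Suc m"] power_mono[of "real (Suc m + 1)" "real (n + 1)" d]
      by (intro add_mono mult_mono) auto
    finally show ?case by (simp add: algebra_simps)
  qed
  from this[of n] show ?case unfolding Suc.hyps(2)[symmetric] by (simp add: U_def)
qed

text \<open>Comparing coefficients in \<open>Q\<^sub>w \<cdot> (1/Q\<^sub>w) = 1\<close> gives a recurrence for the coefficients of \<open>1/Q\<^sub>w\<close> in which
  \<open>w\<close> occurs only as a factor of the immediately preceding one.\<close>
lemma reciprocal_coeff_monic_poly:
  "\<exists>G. degree G = n \<and> lead_coeff G = (1::complex) \<and>
    (\<forall>w. poly G w = fps_nth (inverse (fps_of_poly (reversed_factor B w))) n)"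
proof (induction n rule: less_induct)
  case (less n)
  show ?case
  proof (cases n)
    case 0
    then show ?thesis by (intro exI[of _ 1]) (auto simp: reversed_factor_def)
  next
    case (Suc k)
    obtain G where G: "\<And>m. m \<le> k \<Longrightarrow> degree (G m) = m" "\<And>m. m \<le> k \<Longrightarrow> lead_coeff (G m) = 1"
      "\<And>m w. m \<le> k \<Longrightarrow> poly (G m) w = fps_nth (inverse (fps_of_poly (reversed_factor B w))) m"
      using less.IH unfolding Suc less_Suc_eq_le by metis
    define L where "L = (\<Sum>i\<le>k. smult (- coeff B i) (G (k - i)))"
    define H where "H = pCons 0 (G k) + L"
    have degL: "degree L \<le> k" unfolding L_def
      by (intro degree_sum_le) (auto intro!: order_trans[OF degree_smult_le] simp: G)
    have Gk: "G k \<noteq> 0" using G(2)[of k] by auto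
    have "degree H = Suc k" unfolding H_def using degL G(1)[of k] Gk
      by (subst degree_add_eq_left) auto
    moreover have "coeff H (Suc k) = 1"
      using degL G(1,2)[of k] by (simp add: H_def coeff_eq_0)
    moreover have "poly H w = fps_nth (inverse (fps_of_poly (reversed_factor B w))) (Suc k)" for w
    proof -
      let ?Q = "fps_of_poly (reversed_factor B w)"
      let ?U = "inverse ?Q"
      have "?Q * ?U = 1" by (rule inverse_mult_eq_1') (simp add: reversed_factor_def)
      then have "0 = fps_nth (?Q * ?U) (Suc k)" by simp
      also have "\<dots> = fps_nth ?U (Suc k) + (\<Sum>i\<le>k. fps_nth ?Q (Suc i) * fps_nth ?U (k - i))"
        unfolding fps_mult_nth atLeast0AtMost
        by (subst sum.atMost_Suc_shift) (simp add: reversed_factor_def)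
      also have "(\<Sum>i\<le>k. fps_nth ?Q (Suc i) * fps_nth ?U (k - i))
          = (\<Sum>i\<le>k. coeff B i * fps_nth ?U (k - i)) - (\<Sum>i\<le>k. (if i = 0 then w * fps_nth ?U k else 0))"
        unfolding sum_subtractf[symmetric]
        by (intro sum.cong) (auto simp: reversed_factor_def coeff_pCons algebra_simps split: nat.splits)
      finally show ?thesis
        by (simp add: H_def L_def poly_sum G sum_negf algebra_simps)
    qed
    ultimately show ?thesis using Suc by (intro exI[of _ H]) auto
  qed
qed

text \<open>The coefficients of \<open>1/Q\<^sub>w\<close> grow at most like a power of \<open>n\<close>, uniformly in \<open>w \<in> C\<close>. Read as monic
  polynomials in \<open>w\<close>, they grow at least like \<open>(d/4)\<^sup>n\<close> somewhere on \<open>C\<close>.\<close>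
lemma zero_free_connected_dist_le_4:
  assumes conn: "connected C" and w0: "w0 \<in> C" and w1: "w1 \<in> C"
    and nz: "\<And>w z. w \<in> C \<Longrightarrow> cmod z < 1 \<Longrightarrow> poly (reversed_factor B w) z \<noteq> 0"
  shows "cmod (w1 - w0) \<le> 4"
proof (rule ccontr)
  assume "\<not> cmod (w1 - w0) \<le> 4"
  define r where "r = cmod (w1 - w0) / 4"
  define K where "K = degree B + 1"
  have r: "1 < r" and ne: "w0 \<noteq> w1" using \<open>\<not> _\<close> by (auto simp: r_def)
  have "r ^ n \<le> real (n + 1) ^ K" for n
  proof -
    obtain G where G: "degree G = n" "lead_coeff G = (1::complex)"
      "\<And>w. poly G w = fps_nth (inverse (fps_of_poly (reversed_factor B w))) n"
      using reciprocal_coeff_monic_poly by blast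
    have "cmod (poly G w) \<le> real (n + 1) ^ K" if "w \<in> C" for w
    proof -
      have "cmod (poly G w) \<le> real (n + 1) ^ degree (reversed_factor B w)"
        unfolding G(3) by (rule inverse_poly_coeff_bound)
          (use nz[OF that] in \<open>force simp: reversed_factor_def\<close>)+
      also have "degree (reversed_factor B w) \<le> K"
        using degree_diff_le_max[of B "[:w:]"] by (auto simp: reversed_factor_def K_def)
      then have "real (n + 1) ^ degree (reversed_factor B w) \<le> real (n + 1) ^ K"
        by (intro power_increasing) auto
      finally show ?thesis .
    qed
    from connected_monic_poly_lower_bound[OF conn w0 w1 ne G(2) this] show ?thesis by (simp add: r_def G)
  qed
  moreover have "\<forall>\<^sub>F n in sequentially. real (n + 1) ^ K < r ^ n"
    using r by real_asymp
  ultimately show False using eventually_happens' [OF sequentially_bot] by (metis (mono_tags, lifting) not_le)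
qed

section \<open>Functions that omit the value one\<close>

text \<open>With \<open>s = sqrt (1 - P\<^sup>n)\<close>, where \<open>s(0) = 1\<close>, the new function satisfies \<open>R\<^sup>n = (1 - s) / (1 + s)\<close>. This is
  Landen's transformation: applied to \<open>P\<^sup>n = \<lambda>(q)\<close> it gives \<open>R\<^bsup>2n\<^esup> = \<lambda>(q\<^sup>2)\<close>. The values \<open>\<plusminus>1\<close> of \<open>R\<^sup>n\<close> would force
  \<open>s = 0\<close> or \<open>s = \<infinity>\<close>. The \<open>n\<close>-th root exists because \<open>(1 - s) / (1 + s) = P\<^sup>n / (1 + s)\<^sup>2\<close>, which makes
  \<open>R = P (1 + s)\<^bsup>-2/n\<^esup>\<close>; since \<open>1 + s(0) = 2\<close>, this is where the factor \<open>4\<^bsup>-1/n\<^esup>\<close> comes from.\<close>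
lemma landen_step:
  assumes n: "0 < n" and holP: "P holomorphic_on ball 0 1" and P0: "P 0 = 0"
    and Pnz: "\<And>z. z \<in> ball 0 1 \<Longrightarrow> z \<noteq> 0 \<Longrightarrow> P z \<noteq> 0"
    and omit: "\<And>z. z \<in> ball 0 1 \<Longrightarrow> P z ^ n \<noteq> (1::complex)"
  obtains R where "R holomorphic_on ball 0 1" "R 0 = 0"
    "\<And>z. z \<in> ball 0 1 \<Longrightarrow> z \<noteq> 0 \<Longrightarrow> R z \<noteq> 0"
    "\<And>z. z \<in> ball 0 1 \<Longrightarrow> R z ^ (2 * n) \<noteq> 1"
    "cmod (deriv R 0) = cmod (deriv P 0) * 4 powr (- 1 / n)"
proof -
  have zero: "(0::complex) \<in> ball 0 1" by simp
  obtain l where l: "l holomorphic_on ball 0 1" "\<And>z. z \<in> ball 0 1 \<Longrightarrow> exp (l z) = 1 - P z ^ n"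
    by (rule holomorphic_logarithm_exists[of "ball 0 1" "\<lambda>z. 1 - P z ^ n" 0])
       (use omit holP in \<open>auto intro!: holomorphic_intros\<close>)
  define s where "s z = exp ((l z - l 0) / 2)" for z
  have hols: "s holomorphic_on ball 0 1" unfolding s_def by (intro holomorphic_intros l) auto
  have s2: "s z ^ 2 = 1 - P z ^ n" if "z \<in> ball 0 1" for z
  proof -
    have double_half: "2 * (c / 2) = c" for c :: complex by simp
    have "s z ^ 2 = exp (l z) / exp (l 0)"
      by (simp only: s_def double_half exp_diff flip: exp_double)
    then show ?thesis using l(2)[OF that] l(2)[OF zero] P0 n by (simp add: zero_power)
  qed
  have s0: "s 0 = 1" by (simp add: s_def)
  have s_nz: "s z \<noteq> 0" for z by (simp add: s_def)
  \<comment> \<open>\<open>s = -1\<close> forces \<open>P = 0\<close>, which happens only at \<open>0\<close>, where the branch was chosen with \<open>s = 1\<close>.\<close>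
  have s1: "1 + s z \<noteq> 0" if "z \<in> ball 0 1" for z
  proof
    assume "1 + s z = 0"
    then have "s z = -1" by (simp add: add_eq_0_iff)
    with s2[OF that] have "P z ^ n = 0" by simp
    then have "z = 0" using Pnz[OF that] by auto
    with s0 \<open>s z = -1\<close> show False by simp
  qed
  obtain L where L: "L holomorphic_on ball 0 1" "\<And>z. z \<in> ball 0 1 \<Longrightarrow> exp (L z) = 1 + s z"
    by (rule holomorphic_logarithm_exists[of "ball 0 1" "\<lambda>z. 1 + s z" 0])
       (use s1 hols in \<open>auto intro!: holomorphic_intros\<close>)
  define E where "E z = exp (- 2 * L z / of_nat n)" for z
  have holE: "E holomorphic_on ball 0 1" unfolding E_def using n by (intro holomorphic_intros L) auto
  have En: "E z ^ n = 1 / (1 + s z)\<^sup>2" if "z \<in> ball 0 1" for z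
  proof -
    have "E z ^ n = exp (- (2 * L z))"
      using n by (simp add: E_def flip: exp_of_nat_mult)
    also have "\<dots> = 1 / exp (L z) ^ 2"
      by (simp add: exp_minus inverse_eq_divide flip: exp_double)
    finally show ?thesis using L(2)[OF that] by simp
  qed
  define R where "R z = P z * E z" for z
  have holR: "R holomorphic_on ball 0 1" unfolding R_def by (intro holomorphic_intros holP holE)
  show thesis
  proof (rule that[OF holR])
    show "R 0 = 0" by (simp add: R_def P0)
    show "R z \<noteq> 0" if "z \<in> ball 0 1" "z \<noteq> 0" for z
      using Pnz[OF that] by (simp add: R_def E_def)
    show "R z ^ (2 * n) \<noteq> 1" if z: "z \<in> ball 0 1" for z
    proof
      assume 1: "R z ^ (2 * n) = 1"
      have Rn: "R z ^ n = (1 - s z) * (1 + s z) / (1 + s z)\<^sup>2"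
        using s2[OF z] En[OF z] by (simp add: R_def power_mult_distrib algebra_simps power2_eq_square)
      then have "R z ^ n = (1 - s z) / (1 + s z)"
        using s1[OF z] by (simp add: power2_eq_square)
      then have "((1 - s z) / (1 + s z))\<^sup>2 = 1" using 1 by (metis mult.commute power_mult)
      then have "(1 - s z)\<^sup>2 = (1 + s z)\<^sup>2" using s1[OF z] by (simp add: power_divide)
      then have "s z = 0" by (simp add: power2_eq_square algebra_simps)
      with s_nz show False by blast
    qed
    have dP: "(P has_field_derivative deriv P 0) (at 0)"
      by (rule holomorphic_derivI[OF holP]) auto
    have dE: "(E has_field_derivative deriv E 0) (at 0)"
      by (rule holomorphic_derivI[OF holE]) auto
    have "deriv R 0 = deriv P 0 * E 0"
      unfolding R_def using DERIV_mult[OF dP dE] P0 by (intro DERIV_imp_deriv) simp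
    moreover have "cmod (E 0) = 4 powr (- 1 / n)"
    proof -
      have "exp (L 0) = 2" using L(2)[OF zero] s0 by simp
      then have "exp (Re (L 0)) = 2" by (metis norm_exp_eq_Re norm_numeral)
      then have "Re (L 0) = ln 2" by (metis ln_exp)
      moreover have "ln 4 = 2 * ln (2::real)" using ln_realpow[of 2 2] by simp
      ultimately show ?thesis by (simp add: E_def powr_def)
    qed
    ultimately show "cmod (deriv R 0) = cmod (deriv P 0) * 4 powr (- 1 / n)"
      by (simp add: norm_mult)
  qed
qed

text \<open>The exponents \<open>1 + 1/2 + 1/4 + \<dots>\<close> of \<open>1/4\<close> that the steps with \<open>n = 1, 2, 4, \<dots>\<close> contribute add up to \<open>2\<close>.
  This is the origin of the constant \<open>16\<close>.\<close>
lemma landen_tower: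
  assumes hol: "h holomorphic_on ball 0 1" and h0: "h 0 = 0"
    and hnz: "\<And>z. z \<in> ball 0 1 \<Longrightarrow> z \<noteq> 0 \<Longrightarrow> h z \<noteq> 0"
    and omit: "\<And>z. z \<in> ball 0 1 \<Longrightarrow> h z \<noteq> (1::complex)"
  shows "\<exists>P. P holomorphic_on ball 0 1 \<and> P 0 = 0 \<and>
    (\<forall>z\<in>ball 0 1. z \<noteq> 0 \<longrightarrow> P z \<noteq> 0) \<and> (\<forall>z\<in>ball 0 1. P z ^ (2 ^ k) \<noteq> 1) \<and>
    cmod (deriv P 0) = cmod (deriv h 0) / 16 * 16 powr (1 / 2 ^ k)"
proof (induction k)
  case 0
  show ?case by (rule exI[of _ h]) (use assms in auto)
next
  case (Suc k)
  then obtain P where P: "P holomorphic_on ball 0 1" "P 0 = 0"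
    "\<And>z. z \<in> ball 0 1 \<Longrightarrow> z \<noteq> 0 \<Longrightarrow> P z \<noteq> 0" "\<And>z. z \<in> ball 0 1 \<Longrightarrow> P z ^ (2 ^ k) \<noteq> 1"
    "cmod (deriv P 0) = cmod (deriv h 0) / 16 * 16 powr (1 / 2 ^ k)" by blast
  obtain R where R: "R holomorphic_on ball 0 1" "R 0 = 0"
    "\<And>z. z \<in> ball 0 1 \<Longrightarrow> z \<noteq> 0 \<Longrightarrow> R z \<noteq> 0"
    "\<And>z. z \<in> ball 0 1 \<Longrightarrow> R z ^ (2 * 2 ^ k) \<noteq> 1"
    "cmod (deriv R 0) = cmod (deriv P 0) * 4 powr (- 1 / (2 ^ k :: nat))"
    by (rule landen_step[of "2 ^ k" P]) (use P in auto)
  have "16 powr (1 / 2 ^ k) * 4 powr (- 1 / 2 ^ k) = (16::real) powr (1 / 2 ^ Suc k)"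
  proof -
    have "(16::real) = 4 powr 2" by simp
    then have "16 powr x = (4::real) powr (2 * x)" for x by (metis powr_powr)
    then show ?thesis by (simp add: field_simps flip: powr_add)
  qed
  then show ?case using R P(5) by (intro exI[of _ R]) (simp add: mult.assoc)
qed

lemma dyadic_root_of_unity_near:
  assumes u: "cmod u = 1" and e: "0 < e"
  obtains \<zeta> k where "\<zeta> ^ (2 ^ k) = (1::complex)" "cmod (\<zeta> - u) < e"
proof -
  define x where "x = Arg u / (2 * pi)"
  have ux: "u = cis (2 * pi * x)" using cis_Arg[of u] u by (cases "u = 0") (auto simp: x_def sgn_eq)
  define y where "y k = real_of_int \<lfloor>x * 2 ^ k\<rfloor> / 2 ^ k" for k
  have "y \<longlonglongrightarrow> x"
  proof (rule real_tendsto_sandwich)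
    have "x - (1/2) ^ k \<le> y k" for k
    proof -
      have "x * 2 ^ k - 1 \<le> of_int \<lfloor>x * 2 ^ k\<rfloor>" by linarith
      then have "(x * 2 ^ k - 1) / 2 ^ k \<le> y k" unfolding y_def by (intro divide_right_mono) auto
      then show ?thesis by (simp add: diff_divide_distrib power_divide)
    qed
    then show "\<forall>\<^sub>F k in sequentially. x - (1/2) ^ k \<le> y k" by simp
    show "\<forall>\<^sub>F k in sequentially. y k \<le> x" unfolding y_def
      by (intro always_eventually allI) (simp add: field_simps)
    show "(\<lambda>k. x - (1/2) ^ k) \<longlonglongrightarrow> x" by (rule tendsto_eq_intros | simp add: LIMSEQ_power_zero)+
  qed auto
  then have "(\<lambda>k. cis (2 * pi * y k)) \<longlonglongrightarrow> u" unfolding ux cis_conv_exp by (intro tendsto_intros)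
  then obtain k where k: "cmod (cis (2 * pi * y k) - u) < e" using e by (metis LIMSEQ_iff order_refl)
  have "cis (2 * pi * y k) ^ (2 ^ k) = cis (2 * pi * of_int \<lfloor>x * 2 ^ k\<rfloor>)"
    by (simp add: Complex.DeMoivre y_def)
  also have "\<dots> = 1" by (rule cis_multiple_2pi) auto
  finally show thesis using that k by blast
qed

text \<open>Schottky's theorem for \<open>(f + 1) / 2\<close>, which omits \<open>0\<close> and \<open>1\<close> and equals \<open>1/2\<close> at \<open>0\<close>. The bound is
  uniform in \<open>f\<close>, as Montel's theorem requires.\<close>
lemma omitting_pm1_locally_bounded:
  assumes K: "compact K" "K \<subseteq> ball 0 1"
  obtains b where "\<And>f z. f holomorphic_on ball 0 1 \<Longrightarrow> f 0 = 0 \<Longrightarrow>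
     (\<And>w. w \<in> ball 0 1 \<Longrightarrow> f w \<noteq> 1 \<and> f w \<noteq> -1) \<Longrightarrow> z \<in> K \<Longrightarrow> cmod (f z) \<le> b"
proof -
  \<comment> \<open>Schottky's theorem needs a function on the closed disc. Rescaling by \<open>q\<close> provides one and still leaves
    \<open>K\<close> inside the disc of radius \<open>q\<close> in the new coordinate.\<close>
  obtain q where q: "0 < q" "q < 1" "K \<subseteq> cball 0 (q\<^sup>2)"
  proof -
    obtain p where p: "p < 1" "\<And>z. z \<in> K \<Longrightarrow> cmod z \<le> p"
    proof (cases "K = {}")
      case False
      obtain z where "z \<in> K" "\<And>y. y \<in> K \<Longrightarrow> cmod y \<le> cmod z"
        using continuous_attains_sup[OF K(1) False, of cmod] by (auto intro!: continuous_intros)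
      then show thesis using that[of "cmod z"] K(2) by auto
    qed (use that[of 0] in auto)
    define q where "q = sqrt (max p (1/2))"
    have "q\<^sup>2 = max p (1/2)" unfolding q_def by (intro real_sqrt_pow2) auto
    then show thesis using p by (intro that[of q]) (force simp: q_def)+
  qed
  show thesis
  proof (rule that)
    fix f z assume f: "f holomorphic_on ball 0 1" "f 0 = 0"
      "\<And>w. w \<in> ball 0 1 \<Longrightarrow> f w \<noteq> 1 \<and> f w \<noteq> -1" and z: "z \<in> K"
    have sub: "q * w \<in> ball 0 1" if "w \<in> cball 0 1" for w :: complex
    proof -
      have "q * cmod w \<le> q" using that q by (intro mult_left_le) auto
      then have "q * cmod w < 1" using q(2) by linarith
      then show ?thesis using q(1) by (simp add: norm_mult)
    qed
    define g where "g w = (f (of_real q * w) + 1) / 2" for w :: complex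
    have "(f \<circ> (\<lambda>w. q * w)) holomorphic_on cball 0 1"
      by (rule holomorphic_on_compose_gen[OF _ f(1)]) (use sub in \<open>auto intro!: holomorphic_intros\<close>)
    then have "g holomorphic_on cball 0 1" unfolding g_def o_def by (intro holomorphic_intros) auto
    moreover have "\<not> (g w = 0 \<or> g w = 1)" if "w \<in> cball 0 1" for w
      using f(3)[OF sub[OF that]] by (auto simp: g_def add_eq_0_iff2)
    moreover have "cmod (z / q) \<le> q"
      using z q by (auto simp: norm_divide field_simps power2_eq_square)
    ultimately have "cmod (g (z / q)) \<le> exp (pi * exp (pi * (2 + 2 * (1/2) + 12 * q / (1 - q))))"
      using q f(2) by (intro Schottky[where f = g and z = "z / q" and r = "1/2" and t = q]) (auto simp: g_def)
    moreover have "f z = 2 * g (z / q) - 1" using q by (simp add: g_def field_simps)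
    ultimately show "cmod (f z) \<le> 2 * exp (pi * exp (pi * (2 + 2 * (1/2) + 12 * q / (1 - q)))) + 1"
      using norm_triangle_ineq4[of "2 * g (z / q)" 1] by (simp add: norm_mult)
  qed
qed

text \<open>The functions of the Landen tower form a normal family. By Hurwitz's theorem on zeros, a
  limit \<open>g\<close> omits every root of unity of order a power of two. As \<open>g\<close> is open, it omits the
  closure of these roots within the unit circle, hence the circle itself. So \<open>g\<close> maps the disc into itself
  and the Schwarz lemma bounds its derivative by \<open>1\<close>.\<close>
lemma deriv_le_16_of_omitting_1:
  assumes hol: "h holomorphic_on ball 0 1" and h0: "h 0 = 0"
    and hnz: "\<And>z. z \<in> ball 0 1 \<Longrightarrow> z \<noteq> 0 \<Longrightarrow> h z \<noteq> 0"
    and omit: "\<And>z. z \<in> ball 0 1 \<Longrightarrow> h z \<noteq> (1::complex)"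
  shows "cmod (deriv h 0) \<le> 16"
proof (rule ccontr)
  assume big: "\<not> cmod (deriv h 0) \<le> 16"
  obtain P where P: "\<And>k. P k holomorphic_on ball 0 1" "\<And>k. P k 0 = 0"
    "\<And>k z. z \<in> ball 0 1 \<Longrightarrow> P k z ^ (2 ^ k) \<noteq> 1"
    "\<And>k. cmod (deriv (P k) 0) = cmod (deriv h 0) / 16 * 16 powr (1 / 2 ^ k)"
    using landen_tower[OF assms] by metis
  have omitk: "P k z \<noteq> \<zeta>" if "z \<in> ball 0 1" "\<zeta> ^ (2 ^ m) = 1" "m \<le> k" for k m z \<zeta>
  proof
    assume "P k z = \<zeta>"
    then have "P k z ^ (2 ^ k) = (\<zeta> ^ (2 ^ m)) ^ (2 ^ (k - m))"
      using \<open>m \<le> k\<close> by (simp flip: power_mult power_add)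
    then show False using that P(3) by simp
  qed
  define \<H> where "\<H> = {f. f holomorphic_on ball 0 1 \<and> f 0 = 0 \<and> (\<forall>w\<in>ball 0 1. f w \<noteq> 1 \<and> f w \<noteq> (-1::complex))}"
  \<comment> \<open>\<open>P 0\<close> need not omit \<open>-1\<close>, so the normal family starts at index \<open>1\<close>.\<close>
  obtain g r where g: "g holomorphic_on ball 0 1" and r: "strict_mono (r :: nat \<Rightarrow> nat)"
    and lim: "\<And>x. x \<in> ball 0 1 \<Longrightarrow> (\<lambda>n. P (Suc (r n)) x) \<longlonglongrightarrow> g x"
    and ulim: "\<And>K. compact K \<Longrightarrow> K \<subseteq> ball 0 1 \<Longrightarrow> uniform_limit K ((\<lambda>n. P (Suc n)) \<circ> r) g sequentially"
  proof (rule Montel[of "ball 0 1" \<H> "\<lambda>n. P (Suc n)"])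
    show "\<exists>b. \<forall>f\<in>\<H>. \<forall>z\<in>K. cmod (f z) \<le> b" if "compact K" "K \<subseteq> ball 0 1" for K
      using omitting_pm1_locally_bounded[OF that] unfolding \<H>_def by (metis (mono_tags, lifting) mem_Collect_eq)
    show "range (\<lambda>n. P (Suc n)) \<subseteq> \<H>"
      using P(1,2) omitk[where m = 1 and k = "Suc _"] by (auto simp: \<H>_def)
  qed (auto simp: \<H>_def)
  define p where "p n = P (Suc (r n))" for n
  have p: "p n holomorphic_on ball 0 1" for n by (simp add: p_def P)
  have p_ulim: "uniform_limit K p g sequentially" if "compact K" "K \<subseteq> ball 0 1" for K
    using ulim[OF that] by (simp add: p_def[abs_def] o_def)
  have g0: "g 0 = 0" using lim[of 0] by (simp add: P(2) LIMSEQ_const_iff)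
  have "uniform_limit (ball 0 (1/2)) p g sequentially"
    by (rule uniform_limit_on_subset[OF p_ulim[of "cball 0 (1/2)"]]) auto
  then have "(\<lambda>n. deriv (p n) 0) \<longlonglongrightarrow> deriv g 0"
    by (rule deriv_complex_uniform_limit)
       (auto intro!: always_eventually holomorphic_on_subset[OF p])
  then have "(\<lambda>n. cmod (deriv (p n) 0)) \<longlonglongrightarrow> cmod (deriv g 0)" by (rule tendsto_norm)
  moreover have "cmod (deriv h 0) / 16 \<le> cmod (deriv (p n) 0)" for n
  proof -
    have "(1::real) \<le> 16 powr (1 / 2 ^ Suc (r n))" by (rule ge_one_powr_ge_zero) auto
    then show ?thesis unfolding p_def P(4) using mult_left_mono[of 1 _ "cmod (deriv h 0) / 16"] by auto
  qed
  ultimately have "cmod (deriv h 0) / 16 \<le> cmod (deriv g 0)"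
    by (intro LIMSEQ_le_const) auto
  then have dg: "1 < cmod (deriv g 0)" using big by simp
  have nonconst: "\<not> g constant_on ball 0 1"
  proof
    assume "g constant_on ball 0 1"
    then have "eventually (\<lambda>z. g z = 0) (nhds 0)" 
      using g0 by (auto simp: constant_on_def eventually_nhds intro!: exI[of _ "ball 0 1"])
    then have "deriv g 0 = deriv (\<lambda>_. 0) 0" by (intro deriv_cong_ev) auto
    with dg show False by simp
  qed
  \<comment> \<open>\<open>P k\<close> omits \<open>\<zeta>\<close> once \<open>k \<ge> m\<close>; shifting the subsequence by \<open>m\<close> ensures this for all its members.\<close>
  have g_omit: "g z \<noteq> \<zeta>" if z: "z \<in> ball 0 1" and \<zeta>: "\<zeta> ^ (2 ^ m) = 1" for z \<zeta> m
  proof -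
    have "g z - \<zeta> \<noteq> 0"
    proof (rule Hurwitz_no_zeros[where g = "\<lambda>z. g z - \<zeta>" and ?z0.0 = z and S = "ball 0 1"
        and \<F> = "\<lambda>n z. p (n + m) z - \<zeta>"])
      show "uniform_limit K (\<lambda>n z. p (n + m) z - \<zeta>) (\<lambda>z. g z - \<zeta>) sequentially"
        if K: "compact K" "K \<subseteq> ball 0 1" for K
      proof -
        have "uniform_limit K (\<lambda>n. p (n + m)) g sequentially"
          using p_ulim[OF K] sequentially_offset unfolding uniform_limit_iff by blast
        then show ?thesis by (intro uniform_limit_intros)
      qed
      show "\<not> (\<lambda>z. g z - \<zeta>) constant_on ball 0 1"
        using nonconst by (auto simp: constant_on_def diff_eq_eq)
      show "p (n + m) z - \<zeta> \<noteq> 0" if "z \<in> ball 0 1" for n z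
        using omitk[OF that \<zeta>, of "Suc (r (n + m))"] seq_suble[OF r, of "n + m"] by (simp add: p_def)
    qed (use z in \<open>auto intro!: holomorphic_intros p g\<close>)
    then show ?thesis by simp
  qed
  have opn: "open (g ` ball 0 1)"
    by (rule open_mapping_thm[OF g]) (use nonconst in auto)
  have unit: "cmod (g z) \<noteq> 1" if z: "z \<in> ball 0 1" for z
  proof
    assume 1: "cmod (g z) = 1"
    obtain e where e: "0 < e" "ball (g z) e \<subseteq> g ` ball 0 1"
      using opn z by (meson imageI open_contains_ball)
    obtain \<zeta> k where \<zeta>: "\<zeta> ^ (2 ^ k) = (1::complex)" "cmod (\<zeta> - g z) < e"
      by (rule dyadic_root_of_unity_near[OF 1 e(1)])
    then have "\<zeta> \<in> ball (g z) e" by (simp add: dist_norm norm_minus_commute)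
    then obtain y where "y \<in> ball 0 1" "g y = \<zeta>" using e(2) by blast
    then show False using g_omit \<zeta>(1) by blast
  qed
  have "cmod (g z) < 1" if z: "z \<in> ball 0 1" for z
  proof (rule ccontr)
    assume "\<not> cmod (g z) < 1"
    have "connected ((\<lambda>z. cmod (g z)) ` ball 0 1)"
      by (intro connected_continuous_image continuous_intros holomorphic_on_imp_continuous_on g) auto
    moreover have "0 \<in> (\<lambda>z. cmod (g z)) ` ball 0 1" using g0 by (force intro: image_eqI[of _ _ 0])
    ultimately have "1 \<in> (\<lambda>z. cmod (g z)) ` ball 0 1"
      using z \<open>\<not> cmod (g z) < 1\<close> connectedD_interval[of _ 0 "cmod (g z)" 1] by auto
    then show False using unit by auto
  qed
  then have "cmod (deriv g 0) \<le> 1" by (intro Schwarz_Lemma(2)[OF g g0, of 0]) auto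
  with dg show False by simp
qed

section \<open>Pairs of parameters\<close>

text \<open>The function \<open>h(z) = (w\<^sub>1 - w\<^sub>0) z / Q\<^bsub>w\<^sub>0\<^esub>(z)\<close> satisfies \<open>1 - h = Q\<^bsub>w\<^sub>1\<^esub> / Q\<^bsub>w\<^sub>0\<^esub>\<close>, so it omits
  \<open>1\<close> exactly because \<open>Q\<^bsub>w\<^sub>1\<^esub>\<close> has no zeros.\<close>
lemma zero_free_dist_le_16:
  assumes nz: "\<And>w z. w \<in> {w0, w1} \<Longrightarrow> cmod z < 1 \<Longrightarrow> poly (reversed_factor B w) z \<noteq> 0"
  shows "cmod (w1 - w0) \<le> 16"
proof (cases "w0 = w1")
  case False
  define Q0 where "Q0 = reversed_factor B w0"
  define h where "h z = (w1 - w0) * z / poly Q0 z" for z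
  have Q0: "poly Q0 z \<noteq> 0" if "z \<in> ball 0 1" for z using nz[of w0 z] that by (simp add: Q0_def)
  have holh: "h holomorphic_on ball 0 1" unfolding h_def
    by (intro holomorphic_intros Q0)
  have Q00: "poly Q0 0 = 1" by (simp add: Q0_def reversed_factor_def)
  have "cmod (deriv h 0) \<le> 16"
  proof (rule deriv_le_16_of_omitting_1[OF holh])
    show "h 0 = 0" by (simp add: h_def)
    show "h z \<noteq> 0" if "z \<in> ball 0 1" "z \<noteq> 0" for z
      using Q0[OF that(1)] that(2) False by (simp add: h_def)
    show "h z \<noteq> 1" if "z \<in> ball 0 1" for z
    proof
      assume "h z = 1"
      then have "poly (reversed_factor B w1) z = 0"
        using Q0[OF that] by (simp add: h_def Q0_def reversed_factor_def field_simps)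
      with nz[of w1 z] that show False by simp
    qed
  qed
  moreover have "(h has_field_derivative (w1 - w0)) (at 0)"
    unfolding h_def by (rule derivative_eq_intros poly_DERIV refl | simp add: Q00)+
  ultimately show ?thesis by (simp add: DERIV_imp_deriv)
qed simp

section \<open>Impossibility of stabilization\<close>

lemma schur_stable_imp_reversed_factor_nonzero:
  assumes N: "1 \<le> N" and stable: "schur_stable (closed_loop_factor N \<epsilon> w)" and z: "cmod z \<le> 1"
  shows "poly (reversed_factor (\<Sum>j=1..N. monom (of_real (gain_coeff N \<epsilon> j)) (j - 1)) w) z \<noteq> 0"
proof (cases "z = 0")
  case True
  then show ?thesis by (simp add: reversed_factor_def)
next
  case False
  let ?a = "\<lambda>j. complex_of_real (gain_coeff N \<epsilon> j)"
  have pow: "z ^ N * inverse z ^ (N - j) = z ^ j" if "j \<le> N" for j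
  proof -
    have "z ^ N = z ^ j * z ^ (N - j)" using that by (simp flip: power_add)
    then show ?thesis using False by (simp add: power_inverse)
  qed
  have split: "{1..N} = insert 1 {2..N}" using N by auto
  have "z ^ N * poly (closed_loop_factor N \<epsilon> w) (inverse z)
     = z ^ N * inverse z ^ (N - 0) + (?a 1 - w) * (z ^ N * inverse z ^ (N - 1))
       + (\<Sum>j=2..N. ?a j * (z ^ N * inverse z ^ (N - j)))"
    by (simp add: closed_loop_factor_def poly_sum poly_monom sum_distrib_left algebra_simps)
  also have "\<dots> = 1 + (?a 1 - w) * z + (\<Sum>j=2..N. ?a j * z ^ j)"
    using N by (simp only: pow) (simp add: pow)
  also have "\<dots> = 1 - w * z + (\<Sum>j=1..N. ?a j * z ^ j)"
    unfolding split by (simp add: algebra_simps)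
  also have "(\<Sum>j=1..N. ?a j * z ^ j) = z * (\<Sum>j=1..N. ?a j * z ^ (j - 1))"
    unfolding sum_distrib_left by (intro sum.cong refl) (simp add: power_eq_if)
  finally have "z ^ N * poly (closed_loop_factor N \<epsilon> w) (inverse z)
      = poly (reversed_factor (\<Sum>j=1..N. monom (?a j) (j - 1)) w) z"
    by (simp add: reversed_factor_def poly_sum poly_monom algebra_simps)
  moreover have "poly (closed_loop_factor N \<epsilon> w) (inverse z) \<noteq> 0"
    using stable z False unfolding schur_stable_def
    by (auto simp: norm_inverse inverse_less_1_iff dest!: spec[of _ "inverse z"])
  ultimately show ?thesis using False by (metis mult_eq_0_iff power_not_zero)
qed

lemma ediameter_greaterD:
  assumes "ediameter E > ennreal r" "0 \<le> r"
  obtains z0 z1 where "z0 \<in> E" "z1 \<in> E" "r < cmod (z1 - z0)"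
  using assms by (auto simp: ediameter_def less_SUP_iff ennreal_less_iff)

theorem theorem3:
  fixes F :: "'h \<Rightarrow> real^'m \<Rightarrow> real^'m"
    and H :: "'h set"
    and xstar :: "'h \<Rightarrow> real^'m"
    and M :: "complex set"
  assumes differentiable: "\<And>h x. h \<in> H \<Longrightarrow> F h differentiable (at x)"
    and equilibrium: "\<And>h. h \<in> H \<Longrightarrow> F h (xstar h) = xstar h"
    and locations: "\<And>h. h \<in> H \<Longrightarrow> multipliers (F h) (xstar h) \<subseteq> M"
    and large: "ediameter M > 16 \<or> (\<exists>C \<in> components M. ediameter C > 4)"
  shows "\<forall>N\<ge>1. \<not> (\<exists>\<epsilon> :: nat \<Rightarrow> real.
           locally_stabilizes M N (delayed_feedback N \<epsilon> :: (nat \<Rightarrow> real^'m) \<Rightarrow> real^'m))"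
proof (intro allI impI notI)
  fix N :: nat
  assume N: "1 \<le> N" and "\<exists>\<epsilon>. locally_stabilizes M N (delayed_feedback N \<epsilon> :: (nat \<Rightarrow> real^'m) \<Rightarrow> real^'m)"
  then obtain \<epsilon> where stable: "schur_stable (closed_loop_char_poly N \<epsilon> \<mu>)"
    if "\<forall>k. \<mu> $ k \<in> M" for \<mu> :: "complex^'m"
    unfolding locally_stabilizes_def by metis
  define B where "B = (\<Sum>j=1..N. monom (complex_of_real (gain_coeff N \<epsilon> j)) (j - 1))"
  have nz: "poly (reversed_factor B w) z \<noteq> 0" if "w \<in> M" "cmod z < 1" for w z
    unfolding B_def
  proof (rule schur_stable_imp_reversed_factor_nonzero[OF N])
    \<comment> \<open>If all multipliers are equal to \<open>w\<close>, the characteristic polynomial is a power of one factor.\<close>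
    have "schur_stable (closed_loop_char_poly N \<epsilon> (\<chi> k::'m. w))"
      using that(1) by (intro stable) simp
    then show "schur_stable (closed_loop_factor N \<epsilon> w)"
      by (auto simp: schur_stable_def closed_loop_char_poly_def poly_prod)
  qed (use that in simp)
  show False
    using large
  proof
    assume "ediameter M > 16"
    then obtain w0 w1 where w: "w0 \<in> M" "w1 \<in> M" "16 < cmod (w1 - w0)"
      using ediameter_greaterD[of 16 M] by auto
    then have "cmod (w1 - w0) \<le> 16" by (intro zero_free_dist_le_16[of w0 w1 B] nz) auto
    with w show False by simp
  next
    assume "\<exists>C \<in> components M. ediameter C > 4"
    then obtain C w0 w1 where C: "C \<in> components M" and w: "w0 \<in> C" "w1 \<in> C" "4 < cmod (w1 - w0)"
      using ediameter_greaterD[of 4] by (metis ennreal_numeral zero_le_numeral)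
    have "cmod (w1 - w0) \<le> 4"
      using in_components_connected[OF C] w(1,2) in_components_subset[OF C]
      by (intro zero_free_connected_dist_le_4[of C w0 w1 B] nz) auto
    with w show False by simp
  qed
qed

end
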